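(* For every subset $S$ of $\mathbb{N}\cup\{0\}$ there exists a class of functions $\mathcal{F}_S \subseteq \mathbb{Z}^{\mathbb{Z}}$ such that for every $T\in\mathbb{N}$, $$\operatorname{C}_T(\mathcal{F}_S) = \sup_{n\in\mathbb{N}\cup\{0\}} \big|S\cap\{n,n+1,\dots,n+T-1\}\big|.$$
   Context: $\mathbb{N}=\{1,2,\dots\}$, $[d]=\{1,\dots,d\}$. Let $\mathcal{X}$ be the state space (here $\mathcal{X}=\mathbb{Z}$) and $\mathcal{F}\subseteq\mathcal{X}^{\mathcal{X}}$. Trajectory tree of depth $d$: a sequence $\mathcal{T}=(\mathcal{T}_0,\mathcal{T}_1,\dots,\mathcal{T}_d)$ with $\mathcal{T}_0\in\mathcal{X}$ (the root label) and $\mathcal{T}_t:\{-1,1\}^t\to\mathcal{X}$ for $t\in[d]$. For $\sigma\in\{-1,1\}^d$, write $\sigma_{\le t}=(\sigma_1,\dots,\sigma_t)$ and $\sigma_{<t}=(\sigma_1,\dots,\sigma_{t-1})$. The tree $\mathcal{T}$ is shattered by $\mathcal{F}$ if for every $\sigma\in\{-1,1\}^d$ there is $f_\sigma\in\mathcal{F}$ with $f_\sigma(\mathcal{T}_{t-1}(\sigma_{<t}))=\mathcal{T}_t(\sigma_{\le t})$ for all $t\in[d]$. Branching factor: $\operatorname{B}(\mathcal{T}) := \min_{\sigma\in\{-1,1\}^d}\sum_{t=1}^d \mathbf{1}\{\mathcal{T}_t((\sigma_{<t},-1))\neq\mathcal{T}_t((\sigma_{<t},+1))\}$. Evolution complexity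 at depth $d$: $\operatorname{C}_d(\mathcal{F}) := \sup\{\operatorname{B}(\mathcal{T}) : \mathcal{T}\text{ is a trajectory tree of depth } d \text{ shattered by }\mathcal{F}\}$. *)

theory Defs
  imports Main "HOL-Library.Extended_Nat"
begin

definition signs :: "nat \<Rightarrow> int list set" where
  "signs t = {\<sigma>. length \<sigma> = t \<and> set \<sigma> \<subseteq> {-1, 1}}"

(* A tree (T_0, ..., T_d) is encoded as one function on sign lists: T_t is its restriction to
   signs t, and the root label is its value at the empty list. The definitions below take the
   depth d explicitly and only inspect the values on signs t for t \<le> d. *)
type_synonym 'a trajectory_tree = "int list \<Rightarrow> 'a"

definition shattered :: "nat \<Rightarrow> 'a trajectory_tree \<Rightarrow> ('a \<Rightarrow> 'a) set \<Rightarrow> bool" where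
  "shattered d T F \<longleftrightarrow>
     (\<forall>\<sigma>\<in>signs d. \<exists>f\<in>F. \<forall>t\<in>{1..d}. f (T (take (t - 1) \<sigma>)) = T (take t \<sigma>))"

definition branching_factor :: "nat \<Rightarrow> 'a trajectory_tree \<Rightarrow> nat" where
  "branching_factor d T =
     Min ((\<lambda>\<sigma>. \<Sum>t = 1..d. of_bool (T (take (t - 1) \<sigma> @ [-1]) \<noteq> T (take (t - 1) \<sigma> @ [1]))) ` signs d)"

lemma finite_signs: "finite (signs t)"
  using finite_lists_length_eq[of "{-1, 1 :: int}" t]
  by (simp add: signs_def conj_commute)

lemma signs_nonempty: "signs t \<noteq> {}"
proof -
  have "replicate t 1 \<in> signs t"
    by (auto simp: signs_def)
  then show ?thesis by blast
qed

(* The supremum is taken in enat, so it is 0 if no tree of depth d is shattered,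
   which happens only for the empty class. *)
definition evolution_complexity :: "nat \<Rightarrow> ('a \<Rightarrow> 'a) set \<Rightarrow> enat" where
  "evolution_complexity d F = (SUP T\<in>{T. shattered d T F}. enat (branching_factor d T))"

end

theory Submission
  imports Defs
begin

text \<open>
  The absolute value of the state serves as a clock: every function of the class increases it by
  exactly one, and is free to choose the sign of the new state precisely when the clock lies in
  \<open>S\<close>. A shattered tree with root \<open>x\<close> can therefore branch at step \<open>t\<close> only if
  \<open>\<bar>x\<bar> + t - 1 \<in> S\<close>, and the tree with root \<open>n \<ge> 0\<close> that branches at all such steps is shattered.
\<close>

text \<open>The sign \<open>e\<close> depends on the clock only. Since the clock strictly increases
  along a trajectory, each value of \<open>e\<close> is consulted at most once, so a single function
  can follow any prescribed sequence of signs. The new absolute value is positive, so the two signs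
  give different states.\<close>

definition clock_step :: "nat set \<Rightarrow> (nat \<Rightarrow> int) \<Rightarrow> int \<Rightarrow> int" where
  "clock_step S e x = (if nat \<bar>x\<bar> \<in> S then e (nat \<bar>x\<bar>) * (\<bar>x\<bar> + 1) else \<bar>x\<bar> + 1)"

definition clock_class :: "nat set \<Rightarrow> (int \<Rightarrow> int) set" where
  "clock_class S = clock_step S ` {e. range e \<subseteq> {-1, 1}}"

text \<open>The membership test uses the clock of the parent, hence the \<open>- 1\<close>; the root
  has no parent and gets the label \<open>n\<close> unconditionally.\<close>

definition clock_tree :: "nat set \<Rightarrow> nat \<Rightarrow> int trajectory_tree" where
  "clock_tree S n \<sigma> =
     (if \<sigma> \<noteq> [] \<and> n + length \<sigma> - 1 \<in> S then last \<sigma> * int (n + length \<sigma>) else int (n + length \<sigma>))"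

lemma abs_clock_class:
  assumes "f \<in> clock_class S"
  shows "\<bar>f x\<bar> = \<bar>x\<bar> + 1"
proof -
  obtain e where e: "range e \<subseteq> {-1, 1}" and f: "f = clock_step S e"
    using assms by (auto simp: clock_class_def)
  have "e (nat \<bar>x\<bar>) \<in> {-1, 1}"
    using e by blast
  then show ?thesis
    by (auto simp: f clock_step_def)
qed

lemma clock_class_eqI:
  assumes "f \<in> clock_class S" "nat \<bar>x\<bar> \<notin> S"
  shows "f x = \<bar>x\<bar> + 1"
  using assms by (auto simp: clock_class_def clock_step_def)

lemma signs_nth:
  assumes "\<sigma> \<in> signs d" "i < d"
  shows "\<sigma> ! i \<in> {-1, 1}"
  using assms nth_mem[of i \<sigma>] by (simp add: signs_def subset_iff)

lemma shatteredD:
  assumes "shattered d T F" "\<sigma> \<in> signs d"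
  obtains f where "f \<in> F" "\<And>t. t < d \<Longrightarrow> f (T (take t \<sigma>)) = T (take (Suc t) \<sigma>)"
proof -
  obtain f where "f \<in> F" and f: "\<forall>t\<in>{1..d}. f (T (take (t - 1) \<sigma>)) = T (take t \<sigma>)"
    using assms by (auto simp: shattered_def)
  moreover have "f (T (take t \<sigma>)) = T (take (Suc t) \<sigma>)" if "t < d" for t
    using bspec[OF f, of "Suc t"] that by simp
  ultimately show thesis
    using that by blast
qed

text \<open>One of the two children compared in the branching factor lies off the path \<sigma>.
  Overwriting the sign at position \<open>t\<close> gives another path through the same node, and
  shattering along that path supplies \<open>f\<close>, which may depend on
  \<open>s\<close>.\<close>

lemma shattered_child:
  assumes "shattered d T F" "\<sigma> \<in> signs d" "t < d" "s \<in> {-1, 1}"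
  shows "\<exists>f\<in>F. T (take t \<sigma> @ [s]) = f (T (take t \<sigma>))"
proof -
  have "\<sigma>[t := s] \<in> signs d"
    using assms set_update_subset_insert[of \<sigma> t s] by (auto simp: signs_def)
  then obtain f where "f \<in> F" and f: "f (T (take t (\<sigma>[t := s]))) = T (take (Suc t) (\<sigma>[t := s]))"
    using shatteredD[OF assms(1)] assms(3) by metis
  moreover have "take (Suc t) (\<sigma>[t := s]) = take t \<sigma> @ [s]"
    using assms by (simp add: signs_def take_Suc_conv_app_nth)
  ultimately show ?thesis
    by (intro bexI[of _ f]) simp_all
qed

lemma shattered_clock_abs:
  assumes "shattered d T (clock_class S)" "\<sigma> \<in> signs d" "t \<le> d"
  shows "\<bar>T (take t \<sigma>)\<bar> = \<bar>T []\<bar> + int t"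
proof -
  obtain f where f: "f \<in> clock_class S"
      "\<And>t. t < d \<Longrightarrow> f (T (take t \<sigma>)) = T (take (Suc t) \<sigma>)"
    using shatteredD[OF assms(1,2)] by blast
  show ?thesis
    using \<open>t \<le> d\<close>
  proof (induction t)
    case (Suc t)
    then show ?case
      using abs_clock_class[OF f(1), of "T (take t \<sigma>)"] f(2)[of t] by simp
  qed simp
qed

text \<open>Indexing steps from 0 makes \<open>t\<close> the depth of the branching node, so that
  its clock is the root's clock plus \<open>t\<close>.\<close>

lemma branching_factor_card:
  "branching_factor d T =
     Min ((\<lambda>\<sigma>. card {t\<in>{..<d}. T (take t \<sigma> @ [-1]) \<noteq> T (take t \<sigma> @ [1])}) ` signs d)"
proof -
  have "(\<Sum>t = 1..d. of_bool (T (take (t - 1) \<sigma> @ [-1]) \<noteq> T (take (t - 1) \<sigma> @ [1])) :: nat) =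
      card {t\<in>{..<d}. T (take t \<sigma> @ [-1]) \<noteq> T (take t \<sigma> @ [1])}" for \<sigma>
  proof -
    have "(\<Sum>t = 1..d. of_bool (T (take (t - 1) \<sigma> @ [-1]) \<noteq> T (take (t - 1) \<sigma> @ [1])) :: nat) =
        (\<Sum>t<d. of_bool (T (take t \<sigma> @ [-1]) \<noteq> T (take t \<sigma> @ [1])))"
      by (simp add: sum.atLeast1_atMost_eq)
    then show ?thesis
      by (simp add: sum_of_bool_eq Int_def)
  qed
  then show ?thesis
    by (simp add: branching_factor_def)
qed

text \<open>Positivity of \<open>d\<close> matters because of truncated subtraction: for
  \<open>d = 0\<close> and \<open>n = 0\<close> the interval on the right would be {0} rather than
  empty.\<close>

lemma card_shifted_window:
  fixes S :: "nat set"
  assumes "d \<ge> 1"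
  shows "card {t\<in>{..<d}. n + t \<in> S} = card (S \<inter> {n..n + d - 1})"
proof -
  have "S \<inter> {n..n + d - 1} = (+) n ` {t\<in>{..<d}. n + t \<in> S}"
  proof (intro equalityI subsetI)
    fix m assume "m \<in> S \<inter> {n..n + d - 1}"
    with assms show "m \<in> (+) n ` {t\<in>{..<d}. n + t \<in> S}"
      by (intro image_eqI[of _ _ "m - n"]) auto
  qed auto
  then show ?thesis
    by (simp add: card_image)
qed

lemma branching_factor_clock_le:
  assumes "shattered d T (clock_class S)" "d \<ge> 1"
  shows "branching_factor d T \<le> card (S \<inter> {nat \<bar>T []\<bar>..nat \<bar>T []\<bar> + d - 1})"
proof -
  \<comment> \<open>The branching factor is a minimum, so bounding the count along one arbitrary
    path suffices.\<close>
  obtain \<sigma> where \<sigma>: "\<sigma> \<in> signs d"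
    using signs_nonempty by blast
  have "nat \<bar>T []\<bar> + t \<in> S"
    if t: "t < d" and branch: "T (take t \<sigma> @ [-1]) \<noteq> T (take t \<sigma> @ [1])" for t
  proof (rule ccontr)
    assume "nat \<bar>T []\<bar> + t \<notin> S"
    moreover have "nat \<bar>T (take t \<sigma>)\<bar> = nat \<bar>T []\<bar> + t"
      using shattered_clock_abs[OF assms(1) \<sigma>, of t] t by (simp add: nat_add_distrib)
    ultimately have "nat \<bar>T (take t \<sigma>)\<bar> \<notin> S"
      by simp
    \<comment> \<open>The two children may come from different functions, but all functions of the
      class agree at a state whose clock is outside \<open>S\<close>.\<close>
    then have "T (take t \<sigma> @ [s]) = \<bar>T (take t \<sigma>)\<bar> + 1" if "s \<in> {-1, 1}" for s
      using shattered_child[OF assms(1) \<sigma> t that] clock_class_eqI by metis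
    with branch show False
      by simp
  qed
  then have "card {t\<in>{..<d}. T (take t \<sigma> @ [-1]) \<noteq> T (take t \<sigma> @ [1])} \<le>
      card {t\<in>{..<d}. nat \<bar>T []\<bar> + t \<in> S}"
    by (intro card_mono) auto
  moreover have "branching_factor d T \<le>
      card {t\<in>{..<d}. T (take t \<sigma> @ [-1]) \<noteq> T (take t \<sigma> @ [1])}"
    unfolding branching_factor_card using \<sigma> finite_signs by (intro Min_le) auto
  ultimately show ?thesis
    using card_shifted_window[OF assms(2)] by simp
qed

lemma shattered_clock_tree: "shattered d (clock_tree S n) (clock_class S)"
  unfolding shattered_def
proof
  fix \<sigma> assume \<sigma>: "\<sigma> \<in> signs d"
  \<comment> \<open>Along \<sigma> the clock takes the values n, ..., n + d - 1 before the
    successive steps, so \<open>e\<close> reads off the sign of the step taken at clock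
    \<open>m\<close>; the value 1 elsewhere only keeps \<open>e\<close> sign-valued.\<close>
  define e where "e m = (if n \<le> m \<and> m < n + d then \<sigma> ! (m - n) else 1)" for m
  have "e m \<in> {-1, 1}" for m
    using signs_nth[OF \<sigma>, of "m - n"] by (auto simp: e_def)
  then have "clock_step S e \<in> clock_class S"
    by (auto simp: clock_class_def)
  moreover have "clock_step S e (clock_tree S n (take (t - 1) \<sigma>)) = clock_tree S n (take t \<sigma>)"
    if "t \<in> {1..d}" for t
  proof -
    obtain i where i: "t = Suc i" "i < d"
      using \<open>t \<in> {1..d}\<close> by (cases t) auto
    have len: "length \<sigma> = d"
      using \<sigma> by (simp add: signs_def)
    have "last (take i \<sigma>) \<in> {-1, 1}" if "i > 0"
    proof -
      have "take i \<sigma> \<noteq> []"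
        using that i len by auto
      then show ?thesis
        using signs_nth[OF \<sigma>, of "i - 1"] that i len by (simp add: last_conv_nth)
    qed
    then have "\<bar>clock_tree S n (take i \<sigma>)\<bar> = int (n + i)"
      using i len by (auto simp: clock_tree_def abs_mult)
    moreover have "clock_tree S n (take (Suc i) \<sigma>) =
        (if n + i \<in> S then \<sigma> ! i * int (n + Suc i) else int (n + Suc i))"
      using i len by (auto simp: clock_tree_def take_Suc_conv_app_nth)
    ultimately show ?thesis
      using i by (simp add: clock_step_def e_def nat_add_distrib algebra_simps)
  qed
  ultimately show "\<exists>f\<in>clock_class S. \<forall>t\<in>{1..d}.
      f (clock_tree S n (take (t - 1) \<sigma>)) = clock_tree S n (take t \<sigma>)"
    by blast
qed

lemma branching_factor_clock_tree:
  assumes "d \<ge> 1"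
  shows "branching_factor d (clock_tree S n) = card (S \<inter> {n..n + d - 1})"
proof -
  \<comment> \<open>The children at depth t + 1 have absolute value n + t + 1 > 0, so opposite signs
    separate them. The set is the same for every path, so the minimum is over a singleton.\<close>
  have "{t\<in>{..<d}. clock_tree S n (take t \<sigma> @ [-1]) \<noteq> clock_tree S n (take t \<sigma> @ [1])} =
      {t\<in>{..<d}. n + t \<in> S}" if "\<sigma> \<in> signs d" for \<sigma>
    using that by (auto simp: clock_tree_def signs_def)
  then have "(\<lambda>\<sigma>. card {t\<in>{..<d}. clock_tree S n (take t \<sigma> @ [-1]) \<noteq> clock_tree S n (take t \<sigma> @ [1])})
      ` signs d = {card (S \<inter> {n..n + d - 1})}"
    using signs_nonempty[of d] card_shifted_window[OF assms] by (auto simp: image_iff)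
  then show ?thesis
    by (simp only: branching_factor_card Min_singleton)
qed

theorem theorem10:
  fixes S :: "nat set"
  shows "\<exists>F :: (int \<Rightarrow> int) set. \<forall>T :: nat. T \<ge> 1 \<longrightarrow>
    evolution_complexity T F = (SUP n :: nat. enat (card (S \<inter> {n..n + T - 1})))"
proof (intro exI allI impI)
  fix d :: nat assume d: "d \<ge> 1"
  show "evolution_complexity d (clock_class S) = (SUP n :: nat. enat (card (S \<inter> {n..n + d - 1})))"
    unfolding evolution_complexity_def
  proof (rule antisym)
    show "(SUP T\<in>{T. shattered d T (clock_class S)}. enat (branching_factor d T)) \<le>
        (SUP n. enat (card (S \<inter> {n..n + d - 1})))"
    proof (rule SUP_mono)
      fix T assume "T \<in> {T. shattered d T (clock_class S)}"
      then show "\<exists>n\<in>UNIV. enat (branching_factor d T) \<le> enat (card (S \<inter> {n..n + d - 1}))"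
        \<comment> \<open>The window starts at the clock of the root,
          \<open>nat \<bar>T []\<bar>\<close>.\<close>
        using branching_factor_clock_le[of d T S] d by auto
    qed
    show "(SUP n. enat (card (S \<inter> {n..n + d - 1}))) \<le>
        (SUP T\<in>{T. shattered d T (clock_class S)}. enat (branching_factor d T))"
    proof (rule SUP_mono)
      fix n
      show "\<exists>T\<in>{T. shattered d T (clock_class S)}.
          enat (card (S \<inter> {n..n + d - 1})) \<le> enat (branching_factor d T)"
        using shattered_clock_tree branching_factor_clock_tree[OF d]
        by (intro bexI[of _ "clock_tree S n"]) auto
    qed
  qed
qed

end
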